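(* Consider two finite horizon Markov decision processes (MDPs) with the same state space $\mathcal{X}=\{1,\dots,X\}$, action space $\mathcal{U}=\{1,\dots,U\}$, horizon $N$, costs $c(x,u,k)$ and terminal cost $c_N(x)$, but with distinct transition matrices $P(u)$ and $\bar P(u)$, $u\in\mathcal{U}$, respectively. Suppose that: (A1) for each $u$ and $k$ the cost $c(x,u,k)$ is decreasing in $x$, and $c_N(x)$ is decreasing in $x$; (A2) for both MDPs, each row of the transition matrix is first order dominated by the next row: $P_i(u)\le_s P_{i+1}(u)$ and $\bar P_i(u)\le_s\bar P_{i+1}(u)$ for each $i$ and $u$; (A5) $P_i(u)\ge_s\bar P_i(u)$ for all $i\in\mathcal{X}$, $u\in\mathcal{U}$. Let $\mu^*(P)$ and $\mu^*(\bar P)$ denote optimal policies for the two MDPs and $J_{\mu^*(P)}(x;P)$, $J_{\mu^*(\bar P)}(x;\bar P)$ the expected cumulative costs incurred by these optimal policies in their respective MDPs from initial state $x$. Then $$J_{\mu^*(P)}(x;P)\le J_{\mu^*(\bar P)}(x;\bar P)\quad\text{for all }x\in\mathcal{X}.$$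
   Context: "Increasing" and "decreasing" are meant in the weak sense. $P_i(u)$ denotes the $i$-th row of $P(u)$, where $P_{ij}(u)=\mathbb{P}(x_{k+1}=j\mid x_k=i,u_k=u)$ (similarly $\bar P$). For probability vectors $p,q$ on $\{1,\dots,X\}$, first order stochastic dominance $p\ge_s q$ (equivalently $q\le_s p$) means $\sum_{i\ge j}p(i)\ge\sum_{i\ge j}q(i)$ for all $j$. The expected cumulative cost of a policy is $\mathbb{E}\{\sum_{k=0}^{N-1}c(x_k,u_k,k)+c_N(x_N)\mid x_0=x\}$, to be minimized over policies $u_k=\mu_k(x_k)$. *)

theory Defs
  imports "HOL-Probability.Probability"
begin

text \<open>
  States are \<open>{1..X}\<close> and actions \<open>{1..U}\<close>. A transition law is a function
  \<open>P :: nat \<Rightarrow> nat \<Rightarrow> nat pmf\<close>, where \<open>P u i\<close> is the \<open>i\<close>-th row of the transition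
  matrix \<open>P(u)\<close>; the entry \<open>P\<^sub>i\<^sub>j(u)\<close> is \<open>pmf (P u i) j\<close>.
\<close>

definition transition_law :: "nat \<Rightarrow> nat \<Rightarrow> (nat \<Rightarrow> nat \<Rightarrow> nat pmf) \<Rightarrow> bool" where
  "transition_law X U P \<longleftrightarrow> (\<forall>u\<in>{1..U}. \<forall>i\<in>{1..X}. set_pmf (P u i) \<subseteq> {1..X})"

definition fosd_le :: "nat \<Rightarrow> nat pmf \<Rightarrow> nat pmf \<Rightarrow> bool" where
  "fosd_le X q p \<longleftrightarrow> (\<forall>j\<in>{1..X}. (\<Sum>i=j..X. pmf q i) \<le> (\<Sum>i=j..X. pmf p i))"

text \<open>A policy \<open>\<mu>\<close> applies the action \<open>\<mu> k x\<close> in state \<open>x\<close> at time \<open>k\<close>.\<close>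

definition policy :: "nat \<Rightarrow> nat \<Rightarrow> nat \<Rightarrow> (nat \<Rightarrow> nat \<Rightarrow> nat) \<Rightarrow> bool" where
  "policy X U N \<mu> \<longleftrightarrow> (\<forall>k<N. \<forall>x\<in>{1..X}. \<mu> k x \<in> {1..U})"

text \<open>
  Law of the state trajectory \<open>\<omega> 0, \<dots>, \<omega> n\<close> of the chain controlled by \<open>\<mu>\<close> and started
  in \<open>x\<close>. The values of \<open>\<omega>\<close> beyond \<open>n\<close> are padding.
\<close>

primrec trajectory ::
  "(nat \<Rightarrow> nat \<Rightarrow> nat pmf) \<Rightarrow> (nat \<Rightarrow> nat \<Rightarrow> nat) \<Rightarrow> nat \<Rightarrow> nat \<Rightarrow> (nat \<Rightarrow> nat) pmf" where
  "trajectory P \<mu> x 0 = return_pmf (\<lambda>_. x)"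
| "trajectory P \<mu> x (Suc n) =
     bind_pmf (trajectory P \<mu> x n)
       (\<lambda>\<omega>. map_pmf (fun_upd \<omega> (Suc n)) (P (\<mu> n (\<omega> n)) (\<omega> n)))"

definition expected_cost ::
  "(nat \<Rightarrow> nat \<Rightarrow> nat pmf) \<Rightarrow> (nat \<Rightarrow> nat \<Rightarrow> nat \<Rightarrow> real) \<Rightarrow> (nat \<Rightarrow> real) \<Rightarrow> nat \<Rightarrow>
   (nat \<Rightarrow> nat \<Rightarrow> nat) \<Rightarrow> nat \<Rightarrow> real" where
  "expected_cost P c cN N \<mu> x =
     measure_pmf.expectation (trajectory P \<mu> x N)
       (\<lambda>\<omega>. (\<Sum>k<N. c (\<omega> k) (\<mu> k (\<omega> k)) k) + cN (\<omega> N))"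

text \<open>An optimal policy minimizes the expected cumulative cost from every initial state.\<close>

definition optimal_policy ::
  "nat \<Rightarrow> nat \<Rightarrow> (nat \<Rightarrow> nat \<Rightarrow> nat pmf) \<Rightarrow> (nat \<Rightarrow> nat \<Rightarrow> nat \<Rightarrow> real) \<Rightarrow> (nat \<Rightarrow> real) \<Rightarrow> nat \<Rightarrow>
   (nat \<Rightarrow> nat \<Rightarrow> nat) \<Rightarrow> bool" where
  "optimal_policy X U P c cN N \<mu> \<longleftrightarrow>
     policy X U N \<mu> \<and>
     (\<forall>\<nu>. policy X U N \<nu> \<longrightarrow>
       (\<forall>x\<in>{1..X}. expected_cost P c cN N \<mu> x \<le> expected_cost P c cN N \<nu> x))"

end

theory Submission
  imports Defs
begin

text \<open>
  Peeling off the last decision turns an \<open>Suc n\<close>-stage problem into an \<open>n\<close>-stage problem whose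
  terminal cost is the one-stage cost-to-go, so one can induct on the horizon with the terminal
  cost generalized. If \<open>g\<close> is decreasing, its greedy one-stage cost-to-go \<open>h\<close> under \<open>P\<close> is a minimum
  of decreasing functions, hence decreasing; and since \<open>P\<close> dominates \<open>Pbar\<close>, \<open>h\<close> is at most the
  cost-to-go under \<open>Pbar\<close> of any action and any terminal cost above \<open>g\<close>. Iterating, the greedy
  policy for \<open>P\<close> costs no more than an arbitrary policy for \<open>Pbar\<close>.
\<close>

text \<open>Summation by parts, run as an induction that lowers \<open>m\<close>: the tail beyond
  \<open>m\<close> is nonnegative, so its factor \<open>g (Suc m)\<close> may be raised to
  \<open>g m\<close> before the term \<open>d m * g m\<close> joins it.\<close>

lemma sum_mult_antimono_le:
  fixes d g :: "nat \<Rightarrow> real"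
  assumes g: "antimono_on {m..n} g"
    and tails: "\<And>j. j \<in> {m<..n} \<Longrightarrow> 0 \<le> (\<Sum>i=j..n. d i)"
    and "m \<le> n"
  shows "(\<Sum>i=m..n. d i * g i) \<le> g m * (\<Sum>i=m..n. d i)"
  using \<open>m \<le> n\<close> g tails
proof (induction m rule: inc_induct)
  case base
  then show ?case by simp
next
  case (step m)
  have split: "{m..n} = insert m {Suc m..n}" using step.hyps by auto
  have "antimono_on {Suc m..n} g"
    using step.prems(1) by (rule monotone_on_subset) auto
  then have "(\<Sum>i=Suc m..n. d i * g i) \<le> g (Suc m) * (\<Sum>i=Suc m..n. d i)"
    using step.prems(2) by (intro step.IH) auto
  also have "\<dots> \<le> g m * (\<Sum>i=Suc m..n. d i)"
    using step.hyps step.prems by (intro mult_right_mono) (auto simp: monotone_on_def)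
  finally show ?case by (simp add: split algebra_simps)
qed

text \<open>Take for \<open>d\<close> the difference of the two mass functions. Dominance makes its
  tails nonnegative, and its total is 0 because both laws have mass one on \<open>{1..X}\<close>, so
  the bound \<open>g 1 * 0\<close> vanishes.\<close>

lemma fosd_le_expectation_antimono:
  fixes g :: "nat \<Rightarrow> real"
  assumes "fosd_le X q p" and p: "set_pmf p \<subseteq> {1..X}" and q: "set_pmf q \<subseteq> {1..X}"
    and g: "antimono_on {1..X} g"
  shows "measure_pmf.expectation p g \<le> measure_pmf.expectation q g"
proof -
  have "1 \<le> X" using p set_pmf_not_empty[of p] by fastforce
  have "(\<Sum>i=1..X. (pmf p i - pmf q i) * g i) \<le> g 1 * (\<Sum>i=1..X. pmf p i - pmf q i)"
    using assms(1) \<open>1 \<le> X\<close>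
    by (intro sum_mult_antimono_le g) (auto simp: fosd_le_def sum_subtractf)
  also have "(\<Sum>i=1..X. pmf p i - pmf q i) = 0"
    using p q by (simp add: sum_subtractf sum_pmf_eq_1)
  finally have "(\<Sum>i=1..X. pmf p i * g i) \<le> (\<Sum>i=1..X. pmf q i * g i)"
    by (simp add: left_diff_distrib sum_subtractf)
  moreover have "measure_pmf.expectation r g = (\<Sum>i=1..X. pmf r i * g i)"
    if "set_pmf r \<subseteq> {1..X}" for r
    using that by (subst integral_measure_pmf_real[of "{1..X}"]) (auto simp: mult.commute)
  ultimately show ?thesis using p q by simp
qed

text \<open>Comparisons of neighbouring rows are chained from \<open>i\<close> up to
  \<open>j\<close>.\<close>

lemma antimono_on_expectation:
  fixes g :: "nat \<Rightarrow> real" and K :: "nat \<Rightarrow> nat pmf"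
  assumes K: "\<And>i. i \<in> {1..X} \<Longrightarrow> set_pmf (K i) \<subseteq> {1..X}"
    and mono: "\<And>i. i \<in> {1..<X} \<Longrightarrow> fosd_le X (K i) (K (Suc i))"
    and g: "antimono_on {1..X} g"
  shows "antimono_on {1..X} (\<lambda>i. measure_pmf.expectation (K i) g)"
proof (rule monotone_onI)
  fix i j assume "i \<in> {1..X}" "j \<in> {1..X}" "i \<le> j"
  from \<open>i \<le> j\<close> \<open>j \<in> {1..X}\<close>
  show "measure_pmf.expectation (K j) g \<le> measure_pmf.expectation (K i) g"
  proof (induction j rule: dec_induct)
    case (step j)
    have "measure_pmf.expectation (K (Suc j)) g \<le> measure_pmf.expectation (K j) g"
      using step \<open>i \<in> {1..X}\<close> by (intro fosd_le_expectation_antimono[OF mono _ _ g] K) auto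
    with step \<open>i \<in> {1..X}\<close> show ?case by simp
  qed simp
qed

lemma policy_Suc: "policy X U (Suc n) \<mu> \<longleftrightarrow> policy X U n \<mu> \<and> (\<forall>x\<in>{1..X}. \<mu> n x \<in> {1..U})"
  by (auto simp: policy_def less_Suc_eq)

lemma trajectory_cong:
  assumes "\<And>k. k < n \<Longrightarrow> \<mu> k = \<nu> k"
  shows "trajectory P \<mu> x n = trajectory P \<nu> x n"
  using assms by (induction n) auto

text \<open>Decisions at time \<open>n\<close> and later do not enter an \<open>n\<close>-stage
  cost, so a policy can be overwritten at time \<open>n\<close> without changing it.\<close>

lemma expected_cost_cong:
  assumes "\<And>k. k < n \<Longrightarrow> \<mu> k = \<nu> k"
  shows "expected_cost P c g n \<mu> x = expected_cost P c g n \<nu> x"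
  using assms trajectory_cong[of n \<mu> \<nu> P x] by (simp add: expected_cost_def)

text \<open>Finite support gives integrability and turns expectations over trajectories into finite
  sums; the range of the current state makes the next action admissible.\<close>

lemma trajectory_support:
  assumes P: "transition_law X U P" and x: "x \<in> {1..X}" and pol: "policy X U n \<mu>"
  shows "finite (set_pmf (trajectory P \<mu> x n))"
    and "\<omega> \<in> set_pmf (trajectory P \<mu> x n) \<Longrightarrow> \<omega> n \<in> {1..X}"
proof -
  \<comment> \<open>The claims are proved jointly: the next row has finite support because the
    current state lies in \<open>{1..X}\<close>.\<close>
  have "finite (set_pmf (trajectory P \<mu> x n)) \<and> (\<forall>\<omega>\<in>set_pmf (trajectory P \<mu> x n). \<omega> n \<in> {1..X})"
    using pol
  proof (induction n)
    case 0
    then show ?case using x by simp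
  next
    case (Suc n)
    then have IH: "finite (set_pmf (trajectory P \<mu> x n))"
      "\<And>\<omega>. \<omega> \<in> set_pmf (trajectory P \<mu> x n) \<Longrightarrow> \<omega> n \<in> {1..X}"
      and act: "\<And>y. y \<in> {1..X} \<Longrightarrow> \<mu> n y \<in> {1..U}"
      by (auto simp: policy_Suc)
    have sub: "set_pmf (P (\<mu> n (\<omega> n)) (\<omega> n)) \<subseteq> {1..X}"
      if "\<omega> \<in> set_pmf (trajectory P \<mu> x n)" for \<omega>
      using P IH(2)[OF that] act unfolding transition_law_def by blast
    then have "finite (set_pmf (P (\<mu> n (\<omega> n)) (\<omega> n)))"
      if "\<omega> \<in> set_pmf (trajectory P \<mu> x n)" for \<omega>
      using that by (meson finite_atLeastAtMost finite_subset)
    with sub IH(1) show ?case by fastforce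
  qed
  then show "finite (set_pmf (trajectory P \<mu> x n))"
    and "\<omega> \<in> set_pmf (trajectory P \<mu> x n) \<Longrightarrow> \<omega> n \<in> {1..X}" by auto
qed

text \<open>Condition on the path up to time \<open>n\<close>. Removing the last stage rather than
  the first keeps the initial state and the time index of \<open>c\<close> unshifted.\<close>

lemma expected_cost_Suc:
  assumes P: "transition_law X U P" and x: "x \<in> {1..X}" and pol: "policy X U (Suc n) \<mu>"
  shows "expected_cost P c g (Suc n) \<mu> x =
    expected_cost P c (\<lambda>y. c y (\<mu> n y) n + measure_pmf.expectation (P (\<mu> n y) y) g) n \<mu> x"
proof -
  let ?T = "trajectory P \<mu> x n"
  let ?R = "\<lambda>\<omega>. P (\<mu> n (\<omega> n)) (\<omega> n)"
  let ?S = "\<lambda>\<omega>. \<Sum>k<n. c (\<omega> k) (\<mu> k (\<omega> k)) k"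
  let ?F = "\<lambda>\<omega>. (\<Sum>k<Suc n. c (\<omega> k) (\<mu> k (\<omega> k)) k) + g (\<omega> (Suc n))"
  have pol': "policy X U n \<mu>" and act: "\<And>y. y \<in> {1..X} \<Longrightarrow> \<mu> n y \<in> {1..U}"
    using pol by (auto simp: policy_Suc)
  note supp = trajectory_support[OF P x pol']
  have fin: "finite (set_pmf (?R \<omega>))" if "\<omega> \<in> set_pmf ?T" for \<omega>
    using P act supp(2)[OF that] unfolding transition_law_def
    by (meson finite_atLeastAtMost finite_subset)
  have inner: "measure_pmf.expectation (map_pmf (fun_upd \<omega> (Suc n)) (?R \<omega>)) ?F =
      ?S \<omega> + (c (\<omega> n) (\<mu> n (\<omega> n)) n + measure_pmf.expectation (?R \<omega>) g)"
    if "\<omega> \<in> set_pmf ?T" for \<omega>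
  proof -
    \<comment> \<open>The update at \<open>Suc n\<close> leaves the coordinates up to
      \<open>n\<close> alone, so all running costs are constants under the inner
      expectation.\<close>
    have "measure_pmf.expectation (map_pmf (fun_upd \<omega> (Suc n)) (?R \<omega>)) ?F =
        measure_pmf.expectation (?R \<omega>) (\<lambda>y. ?S \<omega> + c (\<omega> n) (\<mu> n (\<omega> n)) n + g y)"
      by (simp add: integral_map_pmf)
    also have "\<dots> = ?S \<omega> + c (\<omega> n) (\<mu> n (\<omega> n)) n + measure_pmf.expectation (?R \<omega>) g"
      using fin[OF that] by (subst Bochner_Integration.integral_add)
        (auto intro: integrable_measure_pmf_finite)
    finally show ?thesis by simp
  qed
  have "expected_cost P c g (Suc n) \<mu> x =
      (\<Sum>\<omega>\<in>set_pmf ?T. pmf ?T \<omega> *\<^sub>R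
         measure_pmf.expectation (map_pmf (fun_upd \<omega> (Suc n)) (?R \<omega>)) ?F)"
    unfolding expected_cost_def trajectory.simps
    using supp(1) fin by (intro pmf_expectation_bind) auto
  also have "\<dots> = (\<Sum>\<omega>\<in>set_pmf ?T. pmf ?T \<omega> *\<^sub>R
      (?S \<omega> + (c (\<omega> n) (\<mu> n (\<omega> n)) n + measure_pmf.expectation (?R \<omega>) g)))"
    using inner by (intro sum.cong) auto
  also have "\<dots> = expected_cost P c
      (\<lambda>y. c y (\<mu> n y) n + measure_pmf.expectation (P (\<mu> n y) y) g) n \<mu> x"
    unfolding expected_cost_def using supp(1) by (intro integral_measure_pmf[symmetric]) auto
  finally show ?thesis .
qed

text \<open>Two terminal costs are needed because the costs-to-go of the two chains differ after one
  step. Monotonicity is asked of \<open>g\<close> alone: the counterpart of \<open>g'\<close> in the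
  recursion comes from the arbitrary policy \<open>\<pi>\<close> and can fail to be
  decreasing.\<close>

lemma exists_policy_expected_cost_le:
  assumes P: "transition_law X U P" and Q: "transition_law X U Q"
    and c: "\<And>u k. u \<in> {1..U} \<Longrightarrow> k < N \<Longrightarrow> antimono_on {1..X} (\<lambda>x. c x u k)"
    and mono: "\<And>u i. u \<in> {1..U} \<Longrightarrow> i \<in> {1..<X} \<Longrightarrow> fosd_le X (P u i) (P u (Suc i))"
    and dom: "\<And>u i. u \<in> {1..U} \<Longrightarrow> i \<in> {1..X} \<Longrightarrow> fosd_le X (Q u i) (P u i)"
    and pol: "policy X U N \<pi>"
    and g: "antimono_on {1..X} g" and le: "\<And>x. x \<in> {1..X} \<Longrightarrow> g x \<le> g' x"
  shows "\<exists>\<nu>. policy X U N \<nu> \<and>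
    (\<forall>x\<in>{1..X}. expected_cost P c g N \<nu> x \<le> expected_cost Q c g' N \<pi> x)"
  using c pol g le
proof (induction N arbitrary: g g')
  case 0
  then show ?case by (simp add: policy_def expected_cost_def)
next
  case (Suc n)
  \<comment> \<open>\<open>C u y\<close> is the cost of playing \<open>u\<close> in \<open>y\<close>
    at time \<open>n\<close> under \<open>P\<close> and then paying \<open>g\<close>;
    \<open>a\<close> is the greedy choice for it, and \<open>h'\<close> is the cost-to-go of
    \<open>\<pi>\<close> under \<open>Q\<close> with \<open>g'\<close>.\<close>
  define C where "C u y = c y u n + measure_pmf.expectation (P u y) g" for u y
  define a where "a y = arg_min_on (\<lambda>u. C u y) {1..U}" for y
  define h' where "h' y = c y (\<pi> n y) n + measure_pmf.expectation (Q (\<pi> n y) y) g'" for y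
  have pol': "policy X U n \<pi>" and act: "\<And>y. y \<in> {1..X} \<Longrightarrow> \<pi> n y \<in> {1..U}"
    using Suc.prems(2) by (auto simp: policy_Suc)
  \<comment> \<open>The minimum exists because \<open>\<pi> n y\<close> witnesses that
    \<open>{1..U}\<close> is nonempty.\<close>
  have a_in: "a y \<in> {1..U}" if "y \<in> {1..X}" for y
    using act[OF that] unfolding a_def by (intro arg_min_if_finite(1)) auto
  have a_le: "C (a y) y \<le> C u y" if "u \<in> {1..U}" for u y
    using that unfolding a_def by (intro arg_min_least) auto
  have C_antimono: "antimono_on {1..X} (C u)" if u: "u \<in> {1..U}" for u
  proof -
    have "antimono_on {1..X} (\<lambda>y. measure_pmf.expectation (P u y) g)"
      using P u mono Suc.prems(3)
      by (intro antimono_on_expectation) (auto simp: transition_law_def)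
    with Suc.prems(1)[OF u, of n] show ?thesis
      by (auto simp: monotone_on_def C_def intro!: add_mono)
  qed
  have h_antimono: "antimono_on {1..X} (\<lambda>y. C (a y) y)"
  proof (rule monotone_onI)
    fix y z assume yz: "y \<in> {1..X}" "z \<in> {1..X}" "y \<le> z"
    \<comment> \<open>The minimizer of the smaller state \<open>y\<close> serves as a competitor at
      \<open>z\<close>.\<close>
    have "C (a z) z \<le> C (a y) z" using a_le a_in yz by blast
    also have "\<dots> \<le> C (a y) y" using monotone_onD[OF C_antimono[OF a_in]] yz by blast
    finally show "C (a z) z \<le> C (a y) y" .
  qed
  have h_le: "C (a y) y \<le> h' y" if y: "y \<in> {1..X}" for y
  proof -
    note u = act[OF y]
    have sP: "set_pmf (P (\<pi> n y) y) \<subseteq> {1..X}" and sQ: "set_pmf (Q (\<pi> n y) y) \<subseteq> {1..X}"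
      using P Q u y unfolding transition_law_def by blast+
    \<comment> \<open>The kernel is exchanged while the integrand is still the decreasing
      \<open>g\<close>; only then is \<open>g\<close> replaced by \<open>g'\<close>.\<close>
    have "measure_pmf.expectation (P (\<pi> n y) y) g \<le> measure_pmf.expectation (Q (\<pi> n y) y) g"
      using fosd_le_expectation_antimono[OF dom[OF u y] sP sQ Suc.prems(3)] .
    also have "\<dots> \<le> measure_pmf.expectation (Q (\<pi> n y) y) g'"
    proof (rule integral_mono_AE)
      have "finite (set_pmf (Q (\<pi> n y) y))" using sQ finite_subset by blast
      then show "integrable (Q (\<pi> n y) y) g" "integrable (Q (\<pi> n y) y) g'"
        by (auto intro: integrable_measure_pmf_finite)
      show "AE z in Q (\<pi> n y) y. g z \<le> g' z"
        using sQ Suc.prems(4) by (auto simp: AE_measure_pmf_iff)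
    qed
    finally have "C (\<pi> n y) y \<le> h' y" by (simp add: C_def h'_def)
    with a_le[OF u, of y] show ?thesis by simp
  qed
  obtain \<nu> where \<nu>: "policy X U n \<nu>"
    "\<And>x. x \<in> {1..X} \<Longrightarrow> expected_cost P c (\<lambda>y. C (a y) y) n \<nu> x \<le> expected_cost Q c h' n \<pi> x"
    using Suc.IH[OF _ pol' h_antimono h_le] Suc.prems(1) by auto
  let ?\<nu> = "\<nu>(n := a)"
  have pol_\<nu>: "policy X U (Suc n) ?\<nu>"
    using \<nu>(1) a_in by (auto simp: policy_def)
  moreover have "expected_cost P c g (Suc n) ?\<nu> x \<le> expected_cost Q c g' (Suc n) \<pi> x"
    if x: "x \<in> {1..X}" for x
  proof -
    have "expected_cost P c g (Suc n) ?\<nu> x = expected_cost P c (\<lambda>y. C (a y) y) n ?\<nu> x"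
      by (simp add: expected_cost_Suc[OF P x pol_\<nu>] C_def)
    also have "\<dots> = expected_cost P c (\<lambda>y. C (a y) y) n \<nu> x"
      by (rule expected_cost_cong) simp
    also have "\<dots> \<le> expected_cost Q c h' n \<pi> x" by (rule \<nu>(2)[OF x])
    also have "\<dots> = expected_cost Q c g' (Suc n) \<pi> x"
      by (simp add: expected_cost_Suc[OF Q x Suc.prems(2)] h'_def[abs_def])
    finally show ?thesis .
  qed
  ultimately show ?case by blast
qed

theorem theorem3p4p1:
  fixes X U N :: nat
    and c :: "nat \<Rightarrow> nat \<Rightarrow> nat \<Rightarrow> real" and cN :: "nat \<Rightarrow> real"
    and P Pbar :: "nat \<Rightarrow> nat \<Rightarrow> nat pmf"
    and \<mu> \<mu>bar :: "nat \<Rightarrow> nat \<Rightarrow> nat"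
  assumes P: "transition_law X U P"
    and Pbar: "transition_law X U Pbar"
    and A1_running: "\<And>u k. u \<in> {1..U} \<Longrightarrow> k < N \<Longrightarrow> antimono_on {1..X} (\<lambda>x. c x u k)"
    and A1_terminal: "antimono_on {1..X} cN"
    and A2_P: "\<And>u i. u \<in> {1..U} \<Longrightarrow> i \<in> {1..<X} \<Longrightarrow> fosd_le X (P u i) (P u (Suc i))"
    and A2_Pbar: "\<And>u i. u \<in> {1..U} \<Longrightarrow> i \<in> {1..<X} \<Longrightarrow> fosd_le X (Pbar u i) (Pbar u (Suc i))"
    and A5: "\<And>u i. u \<in> {1..U} \<Longrightarrow> i \<in> {1..X} \<Longrightarrow> fosd_le X (Pbar u i) (P u i)"
    and opt_P: "optimal_policy X U P c cN N \<mu>"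
    and opt_Pbar: "optimal_policy X U Pbar c cN N \<mu>bar"
  shows "\<forall>x\<in>{1..X}. expected_cost P c cN N \<mu> x \<le> expected_cost Pbar c cN N \<mu>bar x"
proof -
  have pol: "policy X U N \<mu>bar" using opt_Pbar by (simp add: optimal_policy_def)
  \<comment> \<open>Both terminal costs are \<open>cN\<close>, and the competitor is
    \<open>\<mu>bar\<close>. Optimality of \<open>\<mu>\<close> against the resulting
    \<open>\<nu>\<close> then closes the chain of inequalities.\<close>
  obtain \<nu> where \<nu>: "policy X U N \<nu>"
    "\<And>x. x \<in> {1..X} \<Longrightarrow> expected_cost P c cN N \<nu> x \<le> expected_cost Pbar c cN N \<mu>bar x"
    using exists_policy_expected_cost_le[where c = c and g' = cN,
        OF P Pbar A1_running A2_P A5 pol A1_terminal order_refl] by auto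
  show ?thesis
    using opt_P \<nu> unfolding optimal_policy_def by (meson order_trans)
qed

end
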